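(* Let $x_1,\dots,x_n$ be points of the Poincaré ball $\mathbb{H}_r$ ($r\ge2$), let $w_i=\sqrt{8}\,x_i/(1-\|x_i\|^2)\in\mathbb{R}^r$, and consider the hyperbolic PGA objective $$f(\gamma)=\frac14\sum_{i=1}^n\operatorname{acosh}^2\left(1+d_E(\gamma,w_i)^2\right)$$ as a function of a geodesic (line) $\gamma$ through the origin. If $\gamma$ is such that for all $i$ $$\operatorname{acosh}^2\left(1+d_E(\gamma,w_i)^2\right)<\min\left(1,\tfrac13\|w_i\|^2\right),$$ then $f$ is locally convex at $\gamma$.
   Context: The Poincaré ball $\mathbb{H}_r$ is the open unit ball in $\mathbb{R}^r$ with its hyperbolic metric; geodesics through the origin are diameters, i.e. correspond to Euclidean lines $\mathbb{R}u$ through $0$ with $u\in\mathbb{R}^r$ a unit vector. $d_E(\gamma,w)$ is the Euclidean distance from the point $w\in\mathbb{R}^r$ to the line $\mathbb{R}u$ determined by $\gamma$, so $d_E(\gamma,w)^2=\|(I-uu^T)w\|^2$. The objective $f(\gamma)$ equals $\sum_i d_H(\gamma,x_i)^2$, the sum of squared hyperbolic distances from the points to the geodesic. Identifying $\gamma$ with $u\in S^{r-1}$ (unit sphere), $f$ becomes a smooth function on the sphere, and "locally convex at $\gamma$" means that $f$ is geodesically convex (nonnegative second derivative along every unit-speed great circle) on some neighborhood of $u$ in $S^{r-1}$. *)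

theory Defs
  imports "HOL-Analysis.Analysis"
begin

definition lift_pt :: "real ^ 'r \<Rightarrow> real ^ 'r" where
  "lift_pt x = (sqrt 8 / (1 - (norm x)\<^sup>2)) *\<^sub>R x"

text \<open>A geodesic of the Poincare ball through the origin is represented by the Euclidean line
  \<open>span {u}\<close> containing it, where \<open>u\<close> is a unit vector. The Euclidean distance from a point
  \<open>w\<close> to a line \<open>\<gamma>\<close> is the library's \<open>infdist w \<gamma>\<close>.\<close>

definition acosh_dist_sq :: "(real ^ 'r) set \<Rightarrow> real ^ 'r \<Rightarrow> real" where
  "acosh_dist_sq \<gamma> w = (arcosh (1 + (infdist w \<gamma>)\<^sup>2))\<^sup>2"

definition pga_objective :: "nat \<Rightarrow> (nat \<Rightarrow> real ^ 'r) \<Rightarrow> (real ^ 'r) set \<Rightarrow> real" where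
  "pga_objective n x \<gamma> = 1 / 4 * (\<Sum>i = 1..n. acosh_dist_sq \<gamma> (lift_pt (x i)))"

definition great_circle :: "real ^ 'r \<Rightarrow> real ^ 'r \<Rightarrow> real \<Rightarrow> real ^ 'r" where
  "great_circle p v t = cos t *\<^sub>R p + sin t *\<^sub>R v"

text \<open>Existence of the second derivative is part of the definition, so no value of \<open>deriv\<close>
  at a point of non-differentiability can enter.\<close>

definition nonneg_second_deriv_at :: "(real \<Rightarrow> real) \<Rightarrow> real \<Rightarrow> bool" where
  "nonneg_second_deriv_at g t \<longleftrightarrow>
     (\<exists>g' g''. (\<forall>\<^sub>F s in nhds t. (g has_real_derivative g' s) (at s)) \<and>
               (g' has_real_derivative g'') (at t) \<and> 0 \<le> g'')"

definition geod_convex_on_sphere :: "(real ^ 'r) set \<Rightarrow> (real ^ 'r \<Rightarrow> real) \<Rightarrow> bool" where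
  "geod_convex_on_sphere U F \<longleftrightarrow>
     (\<forall>p v. norm p = 1 \<and> norm v = 1 \<and> p \<bullet> v = 0 \<longrightarrow>
       (\<forall>t. great_circle p v t \<in> U \<longrightarrow>
            nonneg_second_deriv_at (\<lambda>s. F (great_circle p v s)) t))"

definition locally_convex_at :: "(real ^ 'r \<Rightarrow> real) \<Rightarrow> real ^ 'r \<Rightarrow> bool" where
  "locally_convex_at F u \<longleftrightarrow>
     (\<exists>U. openin (top_of_set (sphere 0 1)) U \<and> u \<in> U \<and> geod_convex_on_sphere U F)"

end

theory Submission imports Defs begin

text \<open>Along a great circle, \<open>q t = w \<bullet> \<gamma> t\<close> satisfies \<open>q'' = - q\<close>, and the squared distance from
  \<open>w\<close> to the line is \<open>s = \<parallel>w\<parallel>\<^sup>2 - q\<^sup>2\<close>, with \<open>q'\<^sup>2 \<le> s\<close>. Writing \<open>1 + s = cosh y\<close>, the second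
  derivative of a summand \<open>y\<^sup>2\<close> is affine in \<open>q'\<^sup>2 \<in> [0, s]\<close>, so only the two end points matter.
  At \<open>q'\<^sup>2 = s\<close> nonnegativity amounts to \<open>q\<^sup>2 (2 sinh y - y (cosh y - 1)) \<ge> y sinh\<^sup>2 y\<close>, which
  follows from \<open>\<parallel>w\<parallel>\<^sup>2 > 3 y\<^sup>2\<close> and \<open>y < 1\<close>. These two conditions are open in the line, so the
  pointwise estimate holds on a whole neighbourhood.\<close>

section \<open>Sums and nonnegative multiples\<close>

lemma nonneg_second_deriv_at_sum:
  assumes "finite A" "\<And>i. i \<in> A \<Longrightarrow> nonneg_second_deriv_at (g i) t"
  shows "nonneg_second_deriv_at (\<lambda>s. \<Sum>i\<in>A. g i s) t"
proof -
  have "\<forall>i\<in>A. \<exists>g' g''. (\<forall>\<^sub>F s in nhds t. (g i has_real_derivative g' s) (at s)) \<and>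
      (g' has_real_derivative g'') (at t) \<and> 0 \<le> g''"
    using assms(2) by (simp add: nonneg_second_deriv_at_def)
  then obtain g1 g2 where
    g: "\<And>i. i \<in> A \<Longrightarrow> \<forall>\<^sub>F s in nhds t. (g i has_real_derivative g1 i s) (at s)"
       "\<And>i. i \<in> A \<Longrightarrow> (g1 i has_real_derivative g2 i) (at t)"
       "\<And>i. i \<in> A \<Longrightarrow> 0 \<le> g2 i"
    by metis
  \<comment> \<open>Finiteness of \<open>A\<close> gives one neighbourhood of \<open>t\<close> on
    which all summands are differentiable.\<close>
  have "\<forall>\<^sub>F s in nhds t. \<forall>i\<in>A. (g i has_real_derivative g1 i s) (at s)"
    using assms(1) g(1) by (simp add: eventually_ball_finite)
  then have "\<forall>\<^sub>F s in nhds t. ((\<lambda>s. \<Sum>i\<in>A. g i s) has_real_derivative (\<Sum>i\<in>A. g1 i s)) (at s)"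
    by eventually_elim (auto intro!: DERIV_sum)
  moreover have "((\<lambda>s. \<Sum>i\<in>A. g1 i s) has_real_derivative (\<Sum>i\<in>A. g2 i)) (at t)"
    using g(2) by (auto intro!: DERIV_sum)
  moreover have "0 \<le> (\<Sum>i\<in>A. g2 i)"
    using g(3) by (auto intro!: sum_nonneg)
  ultimately show ?thesis
    unfolding nonneg_second_deriv_at_def
    by (intro exI[of _ "\<lambda>s. \<Sum>i\<in>A. g1 i s"] exI[of _ "\<Sum>i\<in>A. g2 i"] conjI)
qed

lemma nonneg_second_deriv_at_cmult:
  assumes "0 \<le> c" "nonneg_second_deriv_at g t"
  shows "nonneg_second_deriv_at (\<lambda>s. c * g s) t"
proof -
  obtain g1 g2 where
    g: "\<forall>\<^sub>F s in nhds t. (g has_real_derivative g1 s) (at s)"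
       "(g1 has_real_derivative g2) (at t)" "0 \<le> g2"
    using assms(2) unfolding nonneg_second_deriv_at_def by blast
  have "\<forall>\<^sub>F s in nhds t. ((\<lambda>s. c * g s) has_real_derivative c * g1 s) (at s)"
    using g(1) by eventually_elim (rule DERIV_cmult)
  moreover have "((\<lambda>s. c * g1 s) has_real_derivative c * g2) (at t)"
    using g(2) by (rule DERIV_cmult)
  ultimately show ?thesis
    unfolding nonneg_second_deriv_at_def using assms(1) g(3) by fastforce
qed

section \<open>Distance to a line through the origin\<close>

lemma infdist_span_unit_sq:
  fixes v w :: "'a::real_inner"
  assumes "norm v = 1"
  shows "(infdist w (span {v}))\<^sup>2 = (norm w)\<^sup>2 - (w \<bullet> v)\<^sup>2"
proof -
  have vv: "v \<bullet> v = 1"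
    using assms by (simp add: dot_square_norm)
  \<comment> \<open>Completing the square in \<open>c\<close> yields both the nearest point,
    \<open>c = w \<bullet> v\<close>, and the minimal value.\<close>
  have eq: "(dist w (c *\<^sub>R v))\<^sup>2 = (norm w)\<^sup>2 - (w \<bullet> v)\<^sup>2 + (c - w \<bullet> v)\<^sup>2" for c
    unfolding dist_norm power2_norm_eq_inner
    by (simp add: inner_diff_left inner_diff_right inner_commute vv power2_eq_square algebra_simps)
  have "infdist w (span {v}) = dist w ((w \<bullet> v) *\<^sub>R v)"
  proof (rule antisym)
    show "infdist w (span {v}) \<le> dist w ((w \<bullet> v) *\<^sub>R v)"
      by (rule infdist_le) (simp add: span_scale span_base)
    have "dist w ((w \<bullet> v) *\<^sub>R v) \<le> dist w z" if z: "z \<in> span {v}" for z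
    proof -
      obtain c where c: "z = c *\<^sub>R v"
        using z by (auto simp: span_singleton)
      have "(dist w ((w \<bullet> v) *\<^sub>R v))\<^sup>2 \<le> (dist w (c *\<^sub>R v))\<^sup>2"
        unfolding eq by simp
      then show ?thesis
        unfolding c by (rule power2_le_imp_le) (rule zero_le_dist)
    qed
    moreover have "span {v} \<noteq> {}"
      using span_zero by blast
    ultimately show "dist w ((w \<bullet> v) *\<^sub>R v) \<le> infdist w (span {v})"
      by (simp add: infdist_notempty cINF_greatest)
  qed
  then show ?thesis
    using eq[of "w \<bullet> v"] by simp
qed

lemma inner_unit_sq_le:
  fixes v w :: "'a::real_inner"
  assumes "norm v = 1"
  shows "(w \<bullet> v)\<^sup>2 \<le> (norm w)\<^sup>2"
  using infdist_span_unit_sq[OF assms, of w] by (metis diff_ge_0_iff_ge zero_le_power2)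

section \<open>Hyperbolic function estimates\<close>

lemma sinh_cosh_le_quadratic:
  fixes y :: real
  assumes "0 \<le> y" "y \<le> 1"
  shows "cosh y \<le> 1 + y\<^sup>2" "sinh y \<le> 2 * y" "cosh y - 1 \<le> sinh y"
proof -
  have e: "exp y \<le> 1 + y + y\<^sup>2"
    using exp_bound assms by blast
  have l: "1 - y \<le> exp (- y)"
    using exp_ge_add_one_self[of "- y"] by simp
  have "(1 + y) * exp (- y) \<le> exp y * exp (- y)"
    by (intro mult_right_mono) simp_all
  also have "\<dots> = 1"
    by (simp flip: exp_add)
  \<comment> \<open>The product is \<open>1 + y^3\<close>; cancelling \<open>1 + y\<close> then
    bounds \<open>exp (- y)\<close>.\<close>
  also have "1 \<le> (1 + y) * (1 - y + y\<^sup>2)"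
    using assms by (simp add: power2_eq_square algebra_simps)
  finally have u: "exp (- y) \<le> 1 - y + y\<^sup>2"
    using assms by (simp add: mult_le_cancel_left)
  have "y\<^sup>2 \<le> y"
    using assms by (simp add: power2_eq_square mult_left_le)
  then show "sinh y \<le> 2 * y"
    using e l assms by (simp add: sinh_field_def)
  show "cosh y \<le> 1 + y\<^sup>2"
    using e u by (simp add: cosh_field_def)
  have "exp (- y) \<le> 1"
    using assms by simp
  then show "cosh y - 1 \<le> sinh y"
    by (simp add: cosh_field_def sinh_field_def field_simps)
qed

text \<open>Here \<open>Q\<close> and \<open>P\<close> stand for \<open>q\<^sup>2\<close> and \<open>q'\<^sup>2\<close>; the expression is the second derivative
  of \<open>y\<^sup>2\<close> multiplied by \<open>sinh\<^sup>3 y\<close>.\<close>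

lemma second_deriv_numerator_nonneg:
  fixes y P Q :: real
  assumes "0 < y" "y \<le> 1" "0 \<le> P" "P \<le> cosh y - 1" "3 * y\<^sup>2 \<le> Q + (cosh y - 1)"
  shows "0 \<le> 8 * (sinh y - y * cosh y) * (Q * P) + 4 * y * (sinh y)\<^sup>2 * (Q - P)"
proof -
  define c where "c = cosh y"
  define k where "k = sinh y"
  have ks: "0 < k"
    using assms by (simp add: k_def)
  have k2: "k\<^sup>2 = (c - 1) * (c + 1)"
    using sinh_square_eq[of y] unfolding k_def c_def by algebra
  have b: "c \<le> 1 + y\<^sup>2" "k \<le> 2 * y" "c - 1 \<le> k"
    using sinh_cosh_le_quadratic[of y] assms by (auto simp: c_def k_def)
  have c1: "0 < c - 1"
    using cosh_real_strict_mono[of 0 y] assms by (simp add: c_def)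
  \<comment> \<open>Of the \<open>3 * y\<^sup>2\<close> in the hypothesis, \<open>cosh y - 1\<close>
    uses up at most one \<open>y\<^sup>2\<close>.\<close>
  have Q: "2 * y\<^sup>2 \<le> Q"
    using assms b(1) by (simp add: c_def)
  then have Q0: "0 \<le> Q"
    by (meson order_trans zero_le_power2 mult_nonneg_nonneg zero_le_numeral)
  have "y * (c - 1) \<le> 1 * k"
    using assms b c1 by (intro mult_mono) auto
  then have "Q * k \<le> Q * (2 * k - y * (c - 1))"
    using Q0 by (intro mult_left_mono) auto
  moreover have "y * k\<^sup>2 \<le> Q * k"
  proof -
    have "y * k\<^sup>2 = (y * k) * k"
      by (simp add: power2_eq_square)
    also have "\<dots> \<le> (y * (2 * y)) * k"
      using assms b ks by (intro mult_right_mono mult_left_mono) auto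
    also have "\<dots> \<le> Q * k"
      using Q ks by (intro mult_right_mono) (auto simp: power2_eq_square)
    finally show ?thesis .
  qed
  ultimately have end_point: "0 \<le> Q * (2 * k - y * (c - 1)) - y * k\<^sup>2"
    by linarith
  \<comment> \<open>Linear interpolation in \<open>P\<close> between \<open>0\<close> and
    \<open>c - 1\<close>, cleared of the denominator \<open>c - 1\<close>; each weight multiplies
    the value at one end point.\<close>
  have "(c - 1) * (8 * (k - y * c) * (Q * P) + 4 * y * k\<^sup>2 * (Q - P))
      = (c - 1 - P) * (4 * y * k\<^sup>2 * Q)
        + P * (4 * (c - 1) * (Q * (2 * k - y * (c - 1)) - y * k\<^sup>2))"
    unfolding k2 by (simp add: algebra_simps)
  also have "\<dots> \<ge> 0"
    using assms c1 Q0 end_point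
    by (intro add_nonneg_nonneg mult_nonneg_nonneg) (auto simp: c_def)
  finally show ?thesis
    using c1 by (simp add: zero_le_mult_iff c_def k_def)
qed

section \<open>A single summand along a great circle\<close>

text \<open>This is \<open>cosh (2 * x) = 1 + 2 * (sinh x)\<^sup>2\<close>. The right side is
  visibly smooth at \<open>z = 0\<close>, where \<open>arcosh\<close> itself is evaluated at its
  singular point \<open>1\<close>.\<close>

lemma arcosh_one_plus_sq: "(arcosh (1 + z\<^sup>2))\<^sup>2 = 4 * (arsinh (z / sqrt 2))\<^sup>2" for z :: real
proof -
  define x where "x = 2 * arsinh (z / sqrt 2)"
  have "cosh x = (cosh (arsinh (z / sqrt 2)))\<^sup>2 + (sinh (arsinh (z / sqrt 2)))\<^sup>2"
    unfolding x_def by (simp add: cosh_double)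
  also have "\<dots> = 1 + z\<^sup>2"
    by (simp add: cosh_square_eq power_divide)
  finally have "arcosh (1 + z\<^sup>2) = arcosh (cosh \<bar>x\<bar>)"
    by simp
  also have "\<dots> = \<bar>x\<bar>"
    by (rule arcosh_cosh_real) simp
  finally show ?thesis
    by (simp add: x_def power2_eq_square)
qed

text \<open>Here \<open>a\<close> and \<open>b\<close> are the components of a point along an
  orthonormal pair spanning the plane of the circle, and \<open>W\<close> is its squared norm, so
  that \<open>W\<close> is at least the sum of their squares.\<close>

lemma nonneg_second_deriv_arcosh_sq:
  fixes a b W t :: real
  defines "q \<equiv> \<lambda>t. a * cos t + b * sin t"
  assumes W: "a\<^sup>2 + b\<^sup>2 \<le> W"
    and bound: "(arcosh (1 + (W - (q t)\<^sup>2)))\<^sup>2 < min 1 (1 / 3 * W)"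
  shows "nonneg_second_deriv_at (\<lambda>t. (arcosh (1 + (W - (q t)\<^sup>2)))\<^sup>2) t"
proof -
  define p where "p = (\<lambda>t. b * cos t - a * sin t)"
  define s where "s = (\<lambda>t. W - (q t)\<^sup>2)"
  have dq: "(q has_real_derivative p t) (at t)" for t
    unfolding q_def p_def by (auto intro!: derivative_eq_intros)
  have dp: "(p has_real_derivative - q t) (at t)" for t
    unfolding q_def p_def by (auto intro!: derivative_eq_intros)
  have pq: "(p t)\<^sup>2 + (q t)\<^sup>2 = a\<^sup>2 + b\<^sup>2" for t
  proof -
    have "(p t)\<^sup>2 + (q t)\<^sup>2 = (a\<^sup>2 + b\<^sup>2) * ((sin t)\<^sup>2 + (cos t)\<^sup>2)"
      unfolding p_def q_def by algebra
    then show ?thesis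
      by simp
  qed
  have ps: "(p t)\<^sup>2 \<le> s t" for t
    using pq[of t] W by (simp add: s_def)
  have ds: "(s has_real_derivative - 2 * (q t * p t)) (at t)" for t
    unfolding s_def by (auto intro!: derivative_eq_intros dq)
  show ?thesis
  proof (cases "s t = 0")
    case True
    \<comment> \<open>The formula used for \<open>s t > 0\<close> is singular here, but now \<open>w\<close> lies in the plane of the great
      circle, so that \<open>s = p\<^sup>2\<close> identically.\<close>
    then have "W = a\<^sup>2 + b\<^sup>2"
      using pq[of t] W ps[of t] by (simp add: s_def)
    then have "s t = (p t)\<^sup>2" for t
      using pq[of t] by (simp add: s_def)
    then have eq: "(\<lambda>t. (arcosh (1 + (W - (q t)\<^sup>2)))\<^sup>2) = (\<lambda>t. 4 * (arsinh (p t / sqrt 2))\<^sup>2)"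
      by (simp flip: arcosh_one_plus_sq add: s_def)
    define A where "A = (\<lambda>t. arsinh (p t / sqrt 2))"
    define r where "r = (\<lambda>t. - q t / sqrt 2 / sqrt ((p t / sqrt 2)\<^sup>2 + 1))"
    have dA: "(A has_real_derivative r t) (at t)" for t
      unfolding A_def r_def
      using DERIV_chain2[OF arsinh_real_has_field_derivative DERIV_cdivide[OF dp, of "sqrt 2"]]
      by (simp add: mult.commute)
    have pos: "0 < (p t / sqrt 2)\<^sup>2 + 1" for t
      by (simp add: add_nonneg_pos)
    \<comment> \<open>Existence suffices: in the second derivative of \<open>A\<^sup>2\<close> the
      derivative of \<open>r\<close> is multiplied by \<open>A t = 0\<close>, leaving a
      square.\<close>
    have "\<exists>D. (r has_real_derivative D) (at t)"
      unfolding r_def using pos[of t]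
      by (intro exI) (rule derivative_eq_intros dq dp refl | simp)+
    then obtain D where dr: "(r has_real_derivative D) (at t)"
      by blast
    have "p t = 0"
      using True ps[of t] by simp
    then have A0: "A t = 0"
      by (simp add: A_def)
    have "((\<lambda>t. 4 * (A t)\<^sup>2) has_real_derivative 8 * (A t * r t)) (at t)" for t
      by (auto intro!: derivative_eq_intros dA)
    moreover have "((\<lambda>t. 8 * (A t * r t)) has_real_derivative 8 * (r t * r t)) (at t)"
      by (auto intro!: derivative_eq_intros dA dr simp: A0)
    ultimately show ?thesis
      unfolding nonneg_second_deriv_at_def eq A_def
      by (intro exI[of _ "\<lambda>t. 8 * (arsinh (p t / sqrt 2) * r t)"]
          exI[of _ "8 * (r t * r t)"]) auto
  next
    case False
    then have st: "0 < s t"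
      using ps[of t] zero_le_power2[of "p t"] by linarith
    define Y where "Y = (\<lambda>t. arcosh (1 + s t))"
    \<comment> \<open>This is \<open>sinh (Y t)\<close> in algebraic form wherever
      \<open>s t > 0\<close>.\<close>
    define k where "k = (\<lambda>t. sqrt ((1 + s t)\<^sup>2 - 1))"
    have gt: "1 < (1 + s t)\<^sup>2" if "0 < s t" for t
      using that by (simp add: one_less_power)
    have dY: "(Y has_real_derivative - 2 * (q t * p t) / k t) (at t)" if "0 < s t" for t
      unfolding Y_def k_def using that
        DERIV_chain2[OF arcosh_real_has_field_derivative DERIV_add[OF DERIV_const[of 1] ds[of t]]]
      by simp
    have dY2: "((\<lambda>t. (Y t)\<^sup>2) has_real_derivative - 4 * (q t * p t) * Y t / k t) (at t)"
      if "0 < s t" for t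
      by (auto intro!: derivative_eq_intros dY[OF that])
    have kpos: "0 < k t"
      using gt[OF st] by (simp add: k_def)
    have dk: "(k has_real_derivative (1 + s t) * (- 2 * (q t * p t)) / k t) (at t)"
      unfolding k_def using gt[OF st]
      by (auto intro!: derivative_eq_intros ds simp: field_simps)
    have Ypos: "0 < Y t"
      using st by (simp add: Y_def)
    have ch: "cosh (Y t) = 1 + s t"
      using st by (simp add: Y_def)
    have sh: "sinh (Y t) = k t"
      using st by (simp add: Y_def k_def sinh_arcosh_real)
    define N where "N = 8 * (sinh (Y t) - Y t * cosh (Y t)) * ((q t)\<^sup>2 * (p t)\<^sup>2)
        + 4 * Y t * (sinh (Y t))\<^sup>2 * ((q t)\<^sup>2 - (p t)\<^sup>2)"
    have Yb: "(Y t)\<^sup>2 < 1" "3 * (Y t)\<^sup>2 < W"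
      using bound by (simp_all add: Y_def s_def)
    have "Y t \<le> 1"
      using Yb(1) Ypos by (simp add: abs_square_less_1)
    then have "0 \<le> N"
      \<comment> \<open>With \<open>P\<close> and \<open>Q\<close> the squares of \<open>p t\<close>
        and \<open>q t\<close>, \<open>cosh (Y t) - 1\<close> is \<open>s t\<close> and
        \<open>Q + s t\<close> is \<open>W\<close>.\<close>
      unfolding N_def using Ypos ps[of t] Yb(2)
      by (intro second_deriv_numerator_nonneg) (simp_all add: ch s_def)
    moreover have "((\<lambda>t. - 4 * (q t * p t) * Y t / k t) has_real_derivative N / (k t) ^ 3) (at t)"
      using kpos
      by (auto intro!: derivative_eq_intros dq dp dk dY[OF st]
          simp: N_def sh ch field_simps power2_eq_square power3_eq_cube)
    \<comment> \<open>The first-derivative formula was derived only where \<open>s\<close> is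
      positive, so positivity is spread to a neighbourhood by continuity.\<close>
    moreover have "\<forall>\<^sub>F t in nhds t. 0 < s t"
    proof -
      have "isCont s t"
        using ds DERIV_isCont by blast
      then show ?thesis
        using st order_tendstoD(1)[of s "s t" "nhds t" 0]
        by (simp add: continuous_at tendsto_at_iff_tendsto_nhds)
    qed
    then have "\<forall>\<^sub>F t in nhds t.
        ((\<lambda>t. (Y t)\<^sup>2) has_real_derivative - 4 * (q t * p t) * Y t / k t) (at t)"
      by eventually_elim (rule dY2)
    moreover have eq: "(\<lambda>t. (arcosh (1 + (W - (q t)\<^sup>2)))\<^sup>2) = (\<lambda>t. (Y t)\<^sup>2)"
      by (simp add: Y_def s_def)
    ultimately show ?thesis
      unfolding nonneg_second_deriv_at_def eq using kpos
      by (intro exI[of _ "\<lambda>t. - 4 * (q t * p t) * Y t / k t"] exI[of _ "N / (k t) ^ 3"]) simp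
  qed
qed

section \<open>Back to the sphere\<close>

lemma norm_great_circle:
  assumes "norm p = 1" "norm v = 1" "p \<bullet> v = 0"
  shows "norm (great_circle p v t) = 1"
proof -
  have "p \<bullet> p = 1" "v \<bullet> v = 1"
    using assms by (simp_all add: dot_square_norm)
  then have "(norm (great_circle p v t))\<^sup>2 = (sin t)\<^sup>2 + (cos t)\<^sup>2"
    unfolding great_circle_def power2_norm_eq_inner
    using assms(3)
    by (simp add: inner_add_left inner_add_right inner_commute flip: power2_eq_square)
  then show ?thesis
    using norm_ge_zero[of "great_circle p v t"] by (auto simp: power2_eq_1_iff)
qed

text \<open>The residual of \<open>w\<close> after removing both components has nonnegative squared
  norm.\<close>

lemma Bessel_two:
  fixes p v w :: "'a::real_inner"
  assumes "norm p = 1" "norm v = 1" "p \<bullet> v = 0"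
  shows "(w \<bullet> p)\<^sup>2 + (w \<bullet> v)\<^sup>2 \<le> (norm w)\<^sup>2"
proof -
  have "p \<bullet> p = 1" "v \<bullet> v = 1"
    using assms by (simp_all add: dot_square_norm)
  then have "(norm (w - (w \<bullet> p) *\<^sub>R p - (w \<bullet> v) *\<^sub>R v))\<^sup>2
      = (norm w)\<^sup>2 - (w \<bullet> p)\<^sup>2 - (w \<bullet> v)\<^sup>2"
    unfolding power2_norm_eq_inner using assms(3)
    by (simp add: inner_diff_left inner_diff_right inner_commute power2_eq_square algebra_simps)
  then show ?thesis
    by (smt (verit) zero_le_power2)
qed

lemma nonneg_second_deriv_acosh_dist_sq:
  fixes w :: "real ^ 'r"
  assumes pv: "norm p = 1" "norm v = 1" "p \<bullet> v = 0"
    and bound: "acosh_dist_sq (span {great_circle p v t}) w < min 1 (1 / 3 * (norm w)\<^sup>2)"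
  shows "nonneg_second_deriv_at (\<lambda>s. acosh_dist_sq (span {great_circle p v s}) w) t"
proof -
  have eq: "acosh_dist_sq (span {great_circle p v s}) w
      = (arcosh (1 + ((norm w)\<^sup>2 - ((w \<bullet> p) * cos s + (w \<bullet> v) * sin s)\<^sup>2)))\<^sup>2" for s
    unfolding acosh_dist_sq_def infdist_span_unit_sq[OF norm_great_circle[OF pv]]
    by (simp add: great_circle_def inner_add_right mult.commute)
  show ?thesis
    using nonneg_second_deriv_arcosh_sq[OF Bessel_two[OF pv]] bound by (simp add: eq)
qed

text \<open>By the projection formula the distance term is continuous in the unit vector: the
  argument of \<open>arcosh\<close> stays at least \<open>1\<close>, where \<open>arcosh\<close> is
  continuous.\<close>

lemma openin_sphere_acosh_dist_sq_less:
  fixes w :: "real ^ 'r"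
  shows "openin (top_of_set (sphere 0 1)) {v \<in> sphere 0 1. acosh_dist_sq (span {v}) w < c}"
proof -
  have "continuous_on (sphere 0 1) (\<lambda>v. (arcosh (1 + ((norm w)\<^sup>2 - (w \<bullet> v)\<^sup>2)))\<^sup>2)"
    by (intro continuous_on_power continuous_on_compose2[OF continuous_on_arcosh[OF order.refl]]
        continuous_intros) (auto simp: inner_unit_sq_le)
  then have "continuous_on (sphere 0 1) (\<lambda>v. acosh_dist_sq (span {v}) w)"
    by (simp add: acosh_dist_sq_def infdist_span_unit_sq cong: continuous_on_cong_simp)
  from continuous_openin_preimage_gen[OF this open_lessThan[of c]] show ?thesis
    by (simp add: vimage_def Int_def)
qed

theorem lemma4p3:
  fixes x :: "nat \<Rightarrow> real ^ 'r" and n :: nat and u :: "real ^ 'r"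
  assumes "CARD('r) \<ge> 2"
    and "\<And>i. i \<in> {1..n} \<Longrightarrow> x i \<in> ball 0 1"
    and "norm u = 1"
    and "\<And>i. i \<in> {1..n} \<Longrightarrow>
           acosh_dist_sq (span {u}) (lift_pt (x i)) < min 1 (1 / 3 * (norm (lift_pt (x i)))\<^sup>2)"
  shows "locally_convex_at (\<lambda>v. pga_objective n x (span {v})) u"
proof -
  define c where "c = (\<lambda>i. min 1 (1 / 3 * (norm (lift_pt (x i)))\<^sup>2))"
  define U where
    "U = {v \<in> sphere 0 1. \<forall>i\<in>{1..n}. acosh_dist_sq (span {v}) (lift_pt (x i)) < c i}"
  \<comment> \<open>The factor \<open>sphere 0 1\<close> matters for \<open>n = 0\<close>, when the
    indexed intersection is the whole space.\<close>
  have "U = sphere 0 1 \<inter>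
      (\<Inter>i\<in>{1..n}. {v \<in> sphere 0 1. acosh_dist_sq (span {v}) (lift_pt (x i)) < c i})"
    by (auto simp: U_def)
  also have "openin (top_of_set (sphere 0 1)) \<dots>"
    using openin_INT[of "{1..n}" "top_of_set (sphere 0 1)", OF _ openin_sphere_acosh_dist_sq_less]
    by (simp add: Int_commute)
  finally have "openin (top_of_set (sphere 0 1)) U" .
  moreover have "u \<in> U"
    using assms(3,4) by (simp add: U_def c_def)
  moreover have "geod_convex_on_sphere U (\<lambda>v. pga_objective n x (span {v}))"
    unfolding geod_convex_on_sphere_def pga_objective_def
    by (intro allI impI nonneg_second_deriv_at_cmult nonneg_second_deriv_at_sum
        nonneg_second_deriv_acosh_dist_sq) (simp_all add: U_def c_def)
  ultimately show ?thesis
    unfolding locally_convex_at_def by blast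
qed

end
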